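(* For any marked Petri nets $N,N_1,N_2$: (1) $(N,\emptyset,N)$ is a net-abstraction; (2) if $(N_1,Q,N_2)$ is a net-abstraction, then $(N_1,Q',N_3)$ is a net-abstraction in each of the following cases: (T) $Q'=Q$ and $N_3$ is obtained from $N_2$ by removing a redundant transition; (R) $Q'=(Q;\,k\cdot p=l)$, where $N_3$ is obtained from $N_2$ by removing a redundant place $p$ with witnesses $I,v,b$, and $k\cdot p=l$ is its associated marking equation, namely $k=v(p)$ and $l=\sum_{q\in I}v(q)\cdot q+b$; (A) $Q'=(Q;\,a=\sum_{p\in A}p)$, where $a\notin\mathrm{V}(Q)$ and $N_3$ is obtained from $N_2$ by agglomerating (by chain or loop agglomeration) the places of a set $A$ as a new place $a$; (L) $Q'=(Q;\,p\le k)$, where $N_3$ is obtained from $N_2$ by removing a source-sink pair $(p,t)$ with $m_0(p)=k$ ($m_0$ the initial marking of $N_2$).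
   Context: A marked Petri net is a tuple $N=(P,T,\mathrm{Pre},\mathrm{Post},m_0)$ with $P,T$ disjoint finite sets, $\mathrm{Pre},\mathrm{Post}:T\to(P\to\mathbb{N})$, $m_0:P\to\mathbb{N}$. Markings are maps $P\to\mathbb{N}$ (pointwise order/arithmetic); $t$ is enabled at $m$ if $m\ge\mathrm{Pre}(t)$, and firing gives $m-\mathrm{Pre}(t)+\mathrm{Post}(t)$; $\mathcal{R}(N)\subseteq\mathbb{N}^P$ is the set of markings reachable from $m_0$. Pre/post sets: ${}^\bullet t=\{p\mid\mathrm{Pre}(t)(p)>0\}$, $t^\bullet=\{p\mid\mathrm{Post}(t)(p)>0\}$, ${}^\bullet p=\{t\mid\mathrm{Post}(t)(p)>0\}$, $p^\bullet=\{t\mid\mathrm{Pre}(t)(p)>0\}$. Redundant transition: $t$ such that some firing sequence $\sigma$ over $T\setminus\{t\}$ has displacement $\Delta(\sigma)=\Delta(t)$ and hurdle $H(t)\ge H(\sigma)$, where $\Delta(t_1\cdots t_n)=\sum_i(\mathrm{Post}(t_i)-\mathrm{Pre}(t_i))$ and the hurdle is the smallest marking from which the sequence is firable; removing it deletes $t$. Redundant place: $p$ such that there are $I\subseteq P\setminus\{p\}$, $v:I\cup\{p\}\to\mathbb{N}\setminus\{0\}$, $b\in\mathbb{N}$ with $b=v(p)m_0(p)-\sum_{q\in I}v(q)m_0(q)$ and, for all $t\in T$, $v(p)\mathrm{Pre}(t)(p)-\sum_{q\in I}v(q)\mathrm{Pre}(t)(q)\le b$ and $v(p)(\mathrm{Post}(t)(p)-\mathrm{Pre}(t)(p))=\sum_{q\in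 I}v(q)(\mathrm{Post}(t)(q)-\mathrm{Pre}(t)(q))$; removing it deletes $p$. Sum of places: $a=\boxplus_{r\in A}r$ means $m_0(a)=\sum_{r\in A}m_0(r)$ and $\mathrm{Pre}(t)(a)=\sum_{r\in A}\mathrm{Pre}(t)(r)$, $\mathrm{Post}(t)(a)=\sum_{r\in A}\mathrm{Post}(t)(r)$ for all $t$; agglomerating $A$ as $a$ replaces the places of $A$ by $a$. $A=\{p,q\}$ is chain agglomerable if some $t$ has ${}^\bullet t=\{p\}$, $t^\bullet=\{q\}$, $\mathrm{Pre}(t)(p)=\mathrm{Post}(t)(q)=1$, ${}^\bullet q=\{t\}$, $m_0(q)=0$. $A=\{\pi_0,\dots,\pi_{n-1}\}$ is loop agglomerable if for each $i<n$ some $t$ has $\mathrm{Pre}(t)$ equal to $1$ on $\pi_i$ and $0$ elsewhere and $\mathrm{Post}(t)$ equal to $1$ on $\pi_{(i+1)\bmod n}$ and $0$ elsewhere. Source-sink pair $(p,t)$: ${}^\bullet p=\emptyset$, $p^\bullet=\{t\}$, $\mathrm{Pre}(t)$ is $1$ on $p$ and $0$ elsewhere, $\mathrm{Post}(t)=0$; removing it deletes $p$ and $t$. Linear systems: $Q$ denotes a finite system of linear equations and inequalities over non-negative integer variables; place names are used as variables. $\mathrm{V}(Q)$ is its set of variables, $(Q_1;Q_2)$ the concatenation of systems, $\emptyset$ the empty system. $[\![Q]\!]\subseteq\mathbb{N}^{\mathrm{V}(Q)}$ is the set of solutions of $Q$. For $E\subseteq\mathbb{N}^{\mathcal{V}}$: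 $E\downarrow\mathcal{U}$ is the projection (restriction of each element to $\mathcal{U}$), and $E\uparrow\mathcal{U}$ (for $\mathcal{U}\supseteq\mathcal{V}$) is the largest $E'\subseteq\mathbb{N}^{\mathcal{U}}$ with $E'\downarrow\mathcal{V}=E$. A triple $(N_1,Q,N_2)$, with $N_1,N_2$ nets with place sets $P_1,P_2$ (possibly overlapping), is a net-abstraction if $\mathcal{R}(N_1)=\big((\mathcal{R}(N_2)\uparrow\mathcal{V})\cap([\![Q]\!]\uparrow\mathcal{V})\big)\downarrow P_1$ where $\mathcal{V}=\mathrm{V}(Q)\cup P_1\cup P_2$.
   Formalization: In case (A), the new place a is required to be fresh also for N_1 (not a place of N_1 or N_2, besides a not in V(Q)); without a outside N_1 the claim fails when N_1 has an unconstrained place named a. *)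

theory Defs
  imports "HOL-Library.FuncSet" "HOL-Library.Poly_Mapping"
begin

text \<open>
  Places and transitions live in different types, so they are disjoint by typing.  Only the
  values of the components \<open>pre\<close>, \<open>post\<close> and \<open>init\<close> on the declared places and transitions are
  meaningful; every definition below looks at those values only.
\<close>

record ('v, 't) net =
  places :: "'v set"
  transitions :: "'t set"
  pre :: "'t \<Rightarrow> 'v \<Rightarrow> nat"
  post :: "'t \<Rightarrow> 'v \<Rightarrow> nat"
  init :: "'v \<Rightarrow> nat"

definition petri_net :: "('v, 't) net \<Rightarrow> bool" where
  "petri_net N \<longleftrightarrow> finite (places N) \<and> finite (transitions N)"

abbreviation valuations :: "'v set \<Rightarrow> ('v \<Rightarrow> nat) set" where
  "valuations V \<equiv> V \<rightarrow>\<^sub>E UNIV"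

definition enabled :: "('v, 't) net \<Rightarrow> ('v \<Rightarrow> nat) \<Rightarrow> 't \<Rightarrow> bool" where
  "enabled N m t \<longleftrightarrow> t \<in> transitions N \<and> (\<forall>p\<in>places N. pre N t p \<le> m p)"

definition fire :: "('v, 't) net \<Rightarrow> ('v \<Rightarrow> nat) \<Rightarrow> 't \<Rightarrow> ('v \<Rightarrow> nat)" where
  "fire N m t = (\<lambda>p\<in>places N. m p - pre N t p + post N t p)"

inductive_set reachable :: "('v, 't) net \<Rightarrow> ('v \<Rightarrow> nat) set" for N where
  initial: "restrict (init N) (places N) \<in> reachable N"
| step: "m \<in> reachable N \<Longrightarrow> enabled N m t \<Longrightarrow> fire N m t \<in> reachable N"

definition preset_trans :: "('v, 't) net \<Rightarrow> 't \<Rightarrow> 'v set" where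
  "preset_trans N t = {p \<in> places N. pre N t p > 0}"

definition postset_trans :: "('v, 't) net \<Rightarrow> 't \<Rightarrow> 'v set" where
  "postset_trans N t = {p \<in> places N. post N t p > 0}"

definition preset_place :: "('v, 't) net \<Rightarrow> 'v \<Rightarrow> 't set" where
  "preset_place N p = {t \<in> transitions N. post N t p > 0}"

definition postset_place :: "('v, 't) net \<Rightarrow> 'v \<Rightarrow> 't set" where
  "postset_place N p = {t \<in> transitions N. pre N t p > 0}"

fun firable :: "('v, 't) net \<Rightarrow> ('v \<Rightarrow> nat) \<Rightarrow> 't list \<Rightarrow> bool" where
  "firable N m [] \<longleftrightarrow> True"
| "firable N m (t # ts) \<longleftrightarrow> enabled N m t \<and> firable N (fire N m t) ts"

definition displacement :: "('v, 't) net \<Rightarrow> 't list \<Rightarrow> ('v \<Rightarrow> int)" where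
  "displacement N ts = (\<lambda>p\<in>places N. \<Sum>t\<leftarrow>ts. int (post N t p) - int (pre N t p))"

text \<open>
  The order is the pointwise one.  All markings take the same value outside the places, so it
  compares them on the places only.
\<close>

definition hurdle :: "('v, 't) net \<Rightarrow> 't list \<Rightarrow> ('v \<Rightarrow> nat)" where
  "hurdle N ts = (LEAST m. m \<in> valuations (places N) \<and> firable N m ts)"

lemma hurdle_exists:
  assumes "set ts \<subseteq> transitions N"
  shows "\<exists>h\<in>valuations (places N). \<forall>m\<in>valuations (places N). firable N m ts \<longleftrightarrow> h \<le> m"
  using assms
proof (induction ts)
  case Nil
  show ?case
    by (rule bexI[where x = "\<lambda>p\<in>places N. 0"]) (auto simp: le_fun_def PiE_def extensional_def)
next
  case (Cons t ts)
  then obtain h where h: "h \<in> valuations (places N)"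
    "\<And>m. m \<in> valuations (places N) \<Longrightarrow> firable N m ts \<longleftrightarrow> h \<le> m" by auto
  have le_iff: "f \<le> g \<longleftrightarrow> (\<forall>p\<in>places N. f p \<le> g p)"
    if "f \<in> valuations (places N)" "g \<in> valuations (places N)" for f g
    using that by (auto simp: le_fun_def PiE_def extensional_def)
  let ?h = "\<lambda>p\<in>places N. pre N t p + (h p - post N t p)"
  have "firable N m (t # ts) \<longleftrightarrow> ?h \<le> m" if m: "m \<in> valuations (places N)" for m
  proof -
    have "fire N m t \<in> valuations (places N)" by (auto simp: fire_def)
    then have "firable N m (t # ts) \<longleftrightarrow>
        (\<forall>p\<in>places N. pre N t p \<le> m p \<and> h p \<le> m p - pre N t p + post N t p)"
      using Cons.prems h by (auto simp: enabled_def le_iff) (auto simp: fire_def)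
    also have "\<dots> \<longleftrightarrow> (\<forall>p\<in>places N. pre N t p + (h p - post N t p) \<le> m p)"
      by (intro ball_cong) auto
    also have "\<dots> \<longleftrightarrow> ?h \<le> m"
      using m by (subst le_iff) auto
    finally show ?thesis .
  qed
  moreover have "?h \<in> valuations (places N)" by auto
  ultimately show ?case by blast
qed

lemma hurdle:
  assumes "set ts \<subseteq> transitions N"
  shows "hurdle N ts \<in> valuations (places N)"
    and "m \<in> valuations (places N) \<Longrightarrow> firable N m ts \<longleftrightarrow> hurdle N ts \<le> m"
proof -
  obtain h where h: "h \<in> valuations (places N)"
    "\<And>m. m \<in> valuations (places N) \<Longrightarrow> firable N m ts \<longleftrightarrow> h \<le> m"
    using hurdle_exists[OF assms] by blast
  have "hurdle N ts = h"
    unfolding hurdle_def by (rule Least_equality) (use h in auto)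
  then show "hurdle N ts \<in> valuations (places N)"
    and "m \<in> valuations (places N) \<Longrightarrow> firable N m ts \<longleftrightarrow> hurdle N ts \<le> m"
    using h by auto
qed

definition redundant_transition :: "('v, 't) net \<Rightarrow> 't \<Rightarrow> bool" where
  "redundant_transition N t \<longleftrightarrow> t \<in> transitions N \<and>
     (\<exists>ts. set ts \<subseteq> transitions N - {t} \<and>
           displacement N ts = displacement N [t] \<and> hurdle N [t] \<ge> hurdle N ts)"

definition remove_transition :: "('v, 't) net \<Rightarrow> 't \<Rightarrow> ('v, 't) net" where
  "remove_transition N t = N\<lparr>transitions := transitions N - {t}\<rparr>"

definition redundant_place ::
  "('v, 't) net \<Rightarrow> 'v \<Rightarrow> 'v set \<Rightarrow> ('v \<Rightarrow> nat) \<Rightarrow> nat \<Rightarrow> bool" where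
  "redundant_place N p I v b \<longleftrightarrow>
     p \<in> places N \<and> I \<subseteq> places N - {p} \<and> (\<forall>q\<in>insert p I. v q \<noteq> 0) \<and>
     int b = int (v p) * int (init N p) - (\<Sum>q\<in>I. int (v q) * int (init N q)) \<and>
     (\<forall>t\<in>transitions N.
        int (v p) * int (pre N t p) - (\<Sum>q\<in>I. int (v q) * int (pre N t q)) \<le> int b \<and>
        int (v p) * (int (post N t p) - int (pre N t p)) =
          (\<Sum>q\<in>I. int (v q) * (int (post N t q) - int (pre N t q))))"

definition remove_place :: "('v, 't) net \<Rightarrow> 'v \<Rightarrow> ('v, 't) net" where
  "remove_place N p = N\<lparr>places := places N - {p}\<rparr>"

definition agglomerate :: "('v, 't) net \<Rightarrow> 'v set \<Rightarrow> 'v \<Rightarrow> ('v, 't) net" where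
  "agglomerate N A a =
     \<lparr>places = insert a (places N - A),
      transitions = transitions N,
      pre = (\<lambda>t. (pre N t)(a := \<Sum>r\<in>A. pre N t r)),
      post = (\<lambda>t. (post N t)(a := \<Sum>r\<in>A. post N t r)),
      init = (init N)(a := \<Sum>r\<in>A. init N r)\<rparr>"

definition chain_agglomerable :: "('v, 't) net \<Rightarrow> 'v set \<Rightarrow> bool" where
  "chain_agglomerable N A \<longleftrightarrow>
     (\<exists>p\<in>places N. \<exists>q\<in>places N. A = {p, q} \<and>
       (\<exists>t\<in>transitions N.
          preset_trans N t = {p} \<and> postset_trans N t = {q} \<and>
          pre N t p = 1 \<and> post N t q = 1 \<and>
          preset_place N q = {t} \<and> init N q = 0))"

definition loop_agglomerable :: "('v, 't) net \<Rightarrow> 'v set \<Rightarrow> bool" where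
  "loop_agglomerable N A \<longleftrightarrow>
     (\<exists>n \<pi>. A = \<pi> ` {..<n::nat} \<and> A \<subseteq> places N \<and>
       (\<forall>i<n. \<exists>t\<in>transitions N. \<forall>r\<in>places N.
          pre N t r = (if r = \<pi> i then 1 else 0) \<and>
          post N t r = (if r = \<pi> ((i + 1) mod n) then 1 else 0)))"

definition source_sink_pair :: "('v, 't) net \<Rightarrow> 'v \<Rightarrow> 't \<Rightarrow> bool" where
  "source_sink_pair N p t \<longleftrightarrow>
     p \<in> places N \<and> t \<in> transitions N \<and>
     preset_place N p = {} \<and> postset_place N p = {t} \<and>
     (\<forall>r\<in>places N. pre N t r = (if r = p then 1 else 0) \<and> post N t r = 0)"

definition remove_source_sink_pair :: "('v, 't) net \<Rightarrow> 'v \<Rightarrow> 't \<Rightarrow> ('v, 't) net" where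
  "remove_source_sink_pair N p t =
     N\<lparr>places := places N - {p}, transitions := transitions N - {t}\<rparr>"

text \<open>
  An affine expression is a finitely supported family of integer coefficients together with an
  integer constant.  Its variables are those occurring with a non-zero coefficient.
\<close>

datatype 'v lin_expr = Lin (coeffs: "'v \<Rightarrow>\<^sub>0 int") (const: int)

datatype 'v lin_constraint =
    Eq "'v lin_expr" "'v lin_expr"
  | Le "'v lin_expr" "'v lin_expr"
  | Lt "'v lin_expr" "'v lin_expr"

text \<open>The empty system is the empty list, and concatenation of systems is that of lists.\<close>

type_synonym 'v lin_system = "'v lin_constraint list"

definition expr_vars :: "'v lin_expr \<Rightarrow> 'v set" where
  "expr_vars e = Poly_Mapping.keys (coeffs e)"

definition expr_val :: "('v \<Rightarrow> nat) \<Rightarrow> 'v lin_expr \<Rightarrow> int" where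
  "expr_val f e =
     (\<Sum>x\<in>Poly_Mapping.keys (coeffs e). Poly_Mapping.lookup (coeffs e) x * int (f x)) + const e"

fun constraint_vars :: "'v lin_constraint \<Rightarrow> 'v set" where
  "constraint_vars (Eq l r) = expr_vars l \<union> expr_vars r"
| "constraint_vars (Le l r) = expr_vars l \<union> expr_vars r"
| "constraint_vars (Lt l r) = expr_vars l \<union> expr_vars r"

fun satisfies :: "('v \<Rightarrow> nat) \<Rightarrow> 'v lin_constraint \<Rightarrow> bool" where
  "satisfies f (Eq l r) \<longleftrightarrow> expr_val f l = expr_val f r"
| "satisfies f (Le l r) \<longleftrightarrow> expr_val f l \<le> expr_val f r"
| "satisfies f (Lt l r) \<longleftrightarrow> expr_val f l < expr_val f r"

definition system_vars :: "'v lin_system \<Rightarrow> 'v set" where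
  "system_vars Q = (\<Union>c\<in>set Q. constraint_vars c)"

definition solutions :: "'v lin_system \<Rightarrow> ('v \<Rightarrow> nat) set" where
  "solutions Q = {f \<in> valuations (system_vars Q). \<forall>c\<in>set Q. satisfies f c}"

definition term_expr :: "nat \<Rightarrow> 'v \<Rightarrow> 'v lin_expr" where
  "term_expr k p = Lin (Poly_Mapping.single p (int k)) 0"

definition affine_expr :: "'v set \<Rightarrow> ('v \<Rightarrow> nat) \<Rightarrow> nat \<Rightarrow> 'v lin_expr" where
  "affine_expr I v b = Lin (\<Sum>q\<in>I. Poly_Mapping.single q (int (v q))) (int b)"

lemma expr_val_term_expr: "expr_val f (term_expr k p) = int k * int (f p)"
  by (simp add: expr_val_def term_expr_def)

lemma expr_vars_term_expr: "expr_vars (term_expr k p) = (if k = 0 then {} else {p})"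
  by (simp add: expr_vars_def term_expr_def)

lemma lookup_affine_expr:
  assumes "finite I"
  shows "Poly_Mapping.lookup (coeffs (affine_expr I v b)) x = (if x \<in> I then int (v x) else 0)"
  using assms
  by (simp add: affine_expr_def lookup_sum lookup_single when_def)

lemma expr_vars_affine_expr:
  assumes "finite I"
  shows "expr_vars (affine_expr I v b) = {q \<in> I. v q \<noteq> 0}"
  using assms by (auto simp: expr_vars_def in_keys_iff lookup_affine_expr split: if_splits)

lemma expr_val_affine_expr:
  assumes "finite I"
  shows "expr_val f (affine_expr I v b) = (\<Sum>q\<in>I. int (v q) * int (f q)) + int b"
proof -
  have "(\<Sum>x\<in>expr_vars (affine_expr I v b).
          Poly_Mapping.lookup (coeffs (affine_expr I v b)) x * int (f x)) =
        (\<Sum>q\<in>I. int (v q) * int (f q))"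
    using assms
    by (intro sum.mono_neutral_cong_left) (auto simp: expr_vars_affine_expr lookup_affine_expr)
  then show ?thesis
    by (simp add: expr_val_def expr_vars_def) (simp add: affine_expr_def)
qed

definition project :: "('v \<Rightarrow> nat) set \<Rightarrow> 'v set \<Rightarrow> ('v \<Rightarrow> nat) set" where
  "project E U = (\<lambda>f. restrict f U) ` E"

text \<open>
  The set \<open>V\<close> of variables over which \<open>E\<close> is defined is an explicit argument, because it cannot
  be recovered from an empty \<open>E\<close>.  For \<open>V \<subseteq> U\<close> and \<open>E \<subseteq> valuations V\<close> the greatest set exists.
\<close>

definition lift :: "('v \<Rightarrow> nat) set \<Rightarrow> 'v set \<Rightarrow> 'v set \<Rightarrow> ('v \<Rightarrow> nat) set" where
  "lift E V U = (GREATEST E'. E' \<subseteq> valuations U \<and> project E' V = E)"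

lemma lift_eq:
  assumes "V \<subseteq> U" and E: "E \<subseteq> valuations V"
  shows "lift E V U = {f \<in> valuations U. restrict f V \<in> E}"
  unfolding lift_def
proof (rule Greatest_equality)
  have "E \<subseteq> project {f \<in> valuations U. restrict f V \<in> E} V"
  proof
    fix g assume g: "g \<in> E"
    then have "g \<in> extensional V" using E by (auto simp: PiE_def)
    then have "g = restrict (restrict g U) V"
      using assms(1) by (auto simp: Int_absorb1 extensional_restrict)
    then show "g \<in> project {f \<in> valuations U. restrict f V \<in> E} V"
      unfolding project_def using g by (intro image_eqI[where x = "restrict g U"]) auto
  qed
  then show "{f \<in> valuations U. restrict f V \<in> E} \<subseteq> valuations U \<and>
      project {f \<in> valuations U. restrict f V \<in> E} V = E"
    by (auto simp: project_def)
qed (auto simp: project_def)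

definition net_abstraction ::
  "('v, 's) net \<Rightarrow> 'v lin_system \<Rightarrow> ('v, 't) net \<Rightarrow> bool" where
  "net_abstraction N\<^sub>1 Q N\<^sub>2 \<longleftrightarrow>
     petri_net N\<^sub>1 \<and> petri_net N\<^sub>2 \<and>
     (let V = system_vars Q \<union> places N\<^sub>1 \<union> places N\<^sub>2
      in reachable N\<^sub>1 =
           project (lift (reachable N\<^sub>2) (places N\<^sub>2) V \<inter> lift (solutions Q) (system_vars Q) V)
             (places N\<^sub>1))"

end

theory Submission
  imports Defs
begin

text \<open>
  A removed transition is simulated by its witness sequence.  In the other reductions, a marking of
  the large net is reachable iff its image in the reduced net is reachable and the new constraint
  holds.  For a redundant place the constraint is an invariant that determines the tokens on \<open>p\<close> and
  makes \<open>p\<close> never the only obstacle to a firing; for a source-sink pair the tokens on \<open>p\<close> can be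
  drained at will; for agglomerations the tokens of \<open>a\<close> can be moved within \<open>A\<close> by the given
  transitions, so that every distribution with the right sum is reached.
\<close>

section \<open>Total valuations and a lift-free form of net-abstraction\<close>

lemma reachable_valuations: "m \<in> reachable N \<Longrightarrow> m \<in> valuations (places N)"
  by (induction rule: reachable.induct) (auto simp: fire_def)

lemma restrict_reachable: "m \<in> reachable N \<Longrightarrow> restrict m (places N) = m"
  using reachable_valuations[of m N] by (auto simp: PiE_def extensional_restrict)

lemma restrict_eqD: "restrict f A = restrict g A \<Longrightarrow> x \<in> A \<Longrightarrow> f x = g x"
  by (metis restrict_apply')

text \<open>Lets the later inductions argue with total functions \<open>f\<close> and
  \<open>g\<close>, whose values off the places are arbitrary, and check a firing place by
  place.\<close>

lemma reachable_fire_restrict: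
  assumes "restrict f (places N) \<in> reachable N" "t \<in> transitions N"
    and "\<And>p. p \<in> places N \<Longrightarrow> pre N t p \<le> f p"
    and "\<And>p. p \<in> places N \<Longrightarrow> g p = f p - pre N t p + post N t p"
  shows "restrict g (places N) \<in> reachable N"
proof -
  have "fire N (restrict f (places N)) t \<in> reachable N"
    using assms by (intro reachable.step) (auto simp: enabled_def)
  moreover have "fire N (restrict f (places N)) t = restrict g (places N)"
    using assms(4) by (auto simp: fire_def)
  ultimately show ?thesis by simp
qed

lemma satisfies_cong:
  assumes "\<And>x. x \<in> constraint_vars c \<Longrightarrow> f x = g x"
  shows "satisfies f c \<longleftrightarrow> satisfies g c"
proof -
  have expr_val_cong: "expr_val f e = expr_val g e" if "expr_vars e \<subseteq> constraint_vars c" for e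
    using that assms unfolding expr_val_def expr_vars_def
    by (intro arg_cong2[where f = "(+)"] sum.cong) auto
  show ?thesis by (cases c) (auto simp: expr_val_cong)
qed

lemma restrict_mem_solutions:
  "restrict f (system_vars Q) \<in> solutions Q \<longleftrightarrow> (\<forall>c\<in>set Q. satisfies f c)"
proof -
  have "satisfies (restrict f (system_vars Q)) c \<longleftrightarrow> satisfies f c" if "c \<in> set Q" for c
    by (rule satisfies_cong) (use that in \<open>auto simp: system_vars_def\<close>)
  then show ?thesis by (auto simp: solutions_def)
qed

text \<open>Total valuations \<open>'v \<Rightarrow> nat\<close> make the common set of variables irrelevant.\<close>

lemma net_abstraction_iff:
  "net_abstraction N\<^sub>1 Q N\<^sub>2 \<longleftrightarrow> petri_net N\<^sub>1 \<and> petri_net N\<^sub>2 \<and>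
     reachable N\<^sub>1 = {restrict f (places N\<^sub>1) | f.
       restrict f (places N\<^sub>2) \<in> reachable N\<^sub>2 \<and> (\<forall>c\<in>set Q. satisfies f c)}"
proof -
  define V where "V = system_vars Q \<union> places N\<^sub>1 \<union> places N\<^sub>2"
  have "lift (reachable N\<^sub>2) (places N\<^sub>2) V =
      {f \<in> valuations V. restrict f (places N\<^sub>2) \<in> reachable N\<^sub>2}"
    by (rule lift_eq) (auto simp: V_def dest: reachable_valuations)
  moreover have "lift (solutions Q) (system_vars Q) V =
      {f \<in> valuations V. restrict f (system_vars Q) \<in> solutions Q}"
    by (rule lift_eq) (auto simp: V_def solutions_def)
  moreover have "project ({f \<in> valuations V. restrict f (places N\<^sub>2) \<in> reachable N\<^sub>2} \<inter>
        {f \<in> valuations V. \<forall>c\<in>set Q. satisfies f c}) (places N\<^sub>1) =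
      {restrict f (places N\<^sub>1) | f.
         restrict f (places N\<^sub>2) \<in> reachable N\<^sub>2 \<and> (\<forall>c\<in>set Q. satisfies f c)}" (is "?L = ?R")
  proof
    show "?R \<subseteq> ?L"
    proof
      fix m assume "m \<in> ?R"
      then obtain f where f: "m = restrict f (places N\<^sub>1)" "restrict f (places N\<^sub>2) \<in> reachable N\<^sub>2"
        "\<forall>c\<in>set Q. satisfies f c" by auto
      \<comment> \<open>Cutting \<open>f\<close> down to \<open>V\<close> loses nothing:
        \<open>V\<close> contains the variables of \<open>Q\<close> and the places of both
        nets.\<close>
      have "satisfies (restrict f V) c" if "c \<in> set Q" for c
      proof -
        have "satisfies (restrict f V) c \<longleftrightarrow> satisfies f c"
          by (rule satisfies_cong) (use that in \<open>auto simp: V_def system_vars_def\<close>)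
        then show ?thesis using f(3) that by simp
      qed
      moreover have "restrict (restrict f V) (places N\<^sub>1) = restrict f (places N\<^sub>1)"
        "restrict (restrict f V) (places N\<^sub>2) = restrict f (places N\<^sub>2)"
        by (auto simp: V_def restrict_def)
      ultimately show "m \<in> ?L"
        unfolding project_def using f by (intro image_eqI[where x = "restrict f V"]) auto
    qed
  qed (auto simp: project_def)
  ultimately show ?thesis
    unfolding net_abstraction_def Let_def V_def[symmetric] by (simp add: restrict_mem_solutions)
qed

lemma net_abstraction_refl:
  assumes "petri_net N"
  shows "net_abstraction N [] N"
  unfolding net_abstraction_iff using assms restrict_reachable by fastforce

text \<open>Fits the reductions that delete a place, where one valuation \<open>f\<close> can be
  tested on both sides. Agglomeration needs a separate argument, since there the value at the new
  place has to be chosen.\<close>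

lemma net_abstraction_append:
  assumes "net_abstraction N\<^sub>1 Q N\<^sub>2" "petri_net N\<^sub>3"
    and "\<And>f. restrict f (places N\<^sub>2) \<in> reachable N\<^sub>2 \<longleftrightarrow>
      restrict f (places N\<^sub>3) \<in> reachable N\<^sub>3 \<and> (\<forall>c\<in>set Q'. satisfies f c)"
  shows "net_abstraction N\<^sub>1 (Q @ Q') N\<^sub>3"
  using assms unfolding net_abstraction_iff by auto

section \<open>Redundant transitions\<close>

lemma reachable_firable:
  "m \<in> reachable N \<Longrightarrow> firable N m ts \<Longrightarrow> foldl (fire N) m ts \<in> reachable N"
  by (induction ts arbitrary: m) (auto intro: reachable.step)

text \<open>Enabledness makes the truncated subtraction in \<open>fire\<close> exact, so the final
  marking depends only on the start and the displacement.\<close>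

lemma foldl_fire_displacement:
  assumes "firable N m ts" "p \<in> places N"
  shows "int (foldl (fire N) m ts p) = int (m p) + displacement N ts p"
  using assms
proof (induction ts arbitrary: m)
  case (Cons t ts)
  have "int (fire N m t p) = int (m p) + (int (post N t p) - int (pre N t p))"
    using Cons.prems by (auto simp: enabled_def fire_def)
  then show ?case using Cons by (simp add: displacement_def)
qed (simp add: displacement_def)

lemma foldl_fire_valuations:
  "m \<in> valuations (places N) \<Longrightarrow> foldl (fire N) m ts \<in> valuations (places N)"
  by (induction ts arbitrary: m) (auto simp: fire_def)

lemma remove_transition_simps [simp]:
  "places (remove_transition N t) = places N"
  "transitions (remove_transition N t) = transitions N - {t}"
  "fire (remove_transition N t) = fire N"
  "init (remove_transition N t) = init N"
  "enabled (remove_transition N t) m u \<longleftrightarrow> enabled N m u \<and> u \<noteq> t"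
  by (auto simp: remove_transition_def fire_def enabled_def fun_eq_iff)

lemma firable_remove_transition:
  "firable (remove_transition N t) m ts \<longleftrightarrow> firable N m ts \<and> t \<notin> set ts"
  by (induction ts arbitrary: m) auto

lemma reachable_remove_transition:
  assumes "redundant_transition N t"
  shows "reachable (remove_transition N t) = reachable N"
proof
  show "reachable (remove_transition N t) \<subseteq> reachable N"
  proof
    fix m assume "m \<in> reachable (remove_transition N t)"
    then show "m \<in> reachable N"
      by (induction rule: reachable.induct) (auto intro: reachable.initial reachable.step
          simp del: restrict_apply)
  qed
  from assms obtain ts where t: "t \<in> transitions N" and ts: "set ts \<subseteq> transitions N - {t}"
    "displacement N ts = displacement N [t]" "hurdle N ts \<le> hurdle N [t]"
    by (auto simp: redundant_transition_def)
  show "reachable N \<subseteq> reachable (remove_transition N t)"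
  proof
    fix m assume "m \<in> reachable N"
    then show "m \<in> reachable (remove_transition N t)"
    proof (induction rule: reachable.induct)
      case initial
      then show ?case using reachable.initial[of "remove_transition N t"] by (simp del: restrict_apply)
    next
      case (step m u)
      show ?case
      proof (cases "u = t")
        case True
        have m: "m \<in> valuations (places N)" using step reachable_valuations by blast
        have "firable N m [t]" using step True by simp
        \<comment> \<open>\<open>m\<close> lies above the hurdle of \<open>[t]\<close>, hence above
          that of \<open>ts\<close>; so \<open>ts\<close> can be fired instead of
          \<open>t\<close>.\<close>
        then have "hurdle N [t] \<le> m" using hurdle(2)[of "[t]" N m] m t by simp
        then have "hurdle N ts \<le> m" using ts(3) by (rule order.trans[rotated])
        then have fir: "firable N m ts" using hurdle(2)[of ts N m] m ts(1) by blast
        \<comment> \<open>Equal displacements give equality on the places; elsewhere both markings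
          are \<open>undefined\<close>.\<close>
        have "foldl (fire N) m ts = foldl (fire N) m [t]"
        proof (rule PiE_ext)
          show "foldl (fire N) m ts p = foldl (fire N) m [t] p" if "p \<in> places N" for p
            using foldl_fire_displacement[OF fir that]
              foldl_fire_displacement[OF \<open>firable N m [t]\<close> that] ts by simp
        qed (rule foldl_fire_valuations[OF m])+
        moreover have "foldl (fire N) m ts \<in> reachable (remove_transition N t)"
          using reachable_firable[of m "remove_transition N t" ts] fir ts step
          by (auto simp: firable_remove_transition)
        ultimately show ?thesis using True by simp
      qed (use step reachable.step[of m "remove_transition N t" u] in auto)
    qed
  qed
qed

section \<open>Redundant places\<close>

lemma remove_place_simps [simp]:
  "places (remove_place N p) = places N - {p}"
  "transitions (remove_place N p) = transitions N"
  "pre (remove_place N p) = pre N"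
  "post (remove_place N p) = post N"
  "init (remove_place N p) = init N"
  by (simp_all add: remove_place_def)

lemma reachable_remove_place:
  assumes N: "petri_net N" and red: "redundant_place N p I v b"
  shows "restrict f (places N) \<in> reachable N \<longleftrightarrow>
    restrict f (places N - {p}) \<in> reachable (remove_place N p) \<and>
    v p * f p = (\<Sum>q\<in>I. v q * f q) + b"
proof -
  let ?M = "remove_place N p"
  have p: "p \<in> places N" "v p \<noteq> 0" and I: "I \<subseteq> places N - {p}"
    and b: "int b = int (v p) * int (init N p) - (\<Sum>q\<in>I. int (v q) * int (init N q))"
    and hurdle: "\<And>t. t \<in> transitions N \<Longrightarrow>
      int (v p) * int (pre N t p) - (\<Sum>q\<in>I. int (v q) * int (pre N t q)) \<le> int b"
    and disp: "\<And>t. t \<in> transitions N \<Longrightarrow>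
      int (v p) * (int (post N t p) - int (pre N t p)) =
        (\<Sum>q\<in>I. int (v q) * (int (post N t q) - int (pre N t q)))"
    using red by (auto simp: redundant_place_def)
  have sound: "restrict m (places N - {p}) \<in> reachable ?M \<and>
      int (v p) * int (m p) = (\<Sum>q\<in>I. int (v q) * int (m q)) + int b" if "m \<in> reachable N" for m
    using that
  proof (induction rule: reachable.induct)
    case initial
    have "(\<Sum>q\<in>I. int (v q) * int (restrict (init N) (places N) q)) =
        (\<Sum>q\<in>I. int (v q) * int (init N q))"
      using I by (intro sum.cong) auto
    moreover have "restrict (restrict (init N) (places N)) (places N - {p}) =
        restrict (init N) (places N - {p})"
      by (auto simp: restrict_def)
    ultimately show ?case using reachable.initial[of ?M] b p by (simp add: restrict_def)
  next
    case (step m t)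
    have t: "t \<in> transitions N" "\<And>q. q \<in> places N \<Longrightarrow> pre N t q \<le> m q"
      using step by (auto simp: enabled_def)
    have *: "int (fire N m t q) = int (m q) + (int (post N t q) - int (pre N t q))"
      if "q \<in> places N" for q
      using t(2)[OF that] that by (simp add: fire_def)
    have "(\<Sum>q\<in>I. int (v q) * int (fire N m t q)) =
        (\<Sum>q\<in>I. int (v q) * int (m q) + int (v q) * (int (post N t q) - int (pre N t q)))"
      by (intro sum.cong) (use I * in \<open>auto simp: distrib_left\<close>)
    also have "\<dots> = (\<Sum>q\<in>I. int (v q) * int (m q)) +
        int (v p) * (int (post N t p) - int (pre N t p))"
      by (simp only: sum.distrib disp[OF t(1)])
    finally have "int (v p) * int (fire N m t p) =
        (\<Sum>q\<in>I. int (v q) * int (fire N m t q)) + int b"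
      using step *[OF p(1)] by (simp add: distrib_left)
    moreover have "restrict (fire N m t) (places ?M) \<in> reachable ?M"
    proof (rule reachable_fire_restrict[of m _ t])
      show "restrict m (places ?M) \<in> reachable ?M" using step.IH by (simp del: restrict_apply)
    qed (use t in \<open>auto simp: fire_def\<close>)
    ultimately show ?case by (simp del: restrict_apply)
  qed
  \<comment> \<open>\<open>m\<close> does not record the tokens on \<open>p\<close>, hence the
    existential; the invariant recovers their number at the end.\<close>
  have complete: "\<exists>g. restrict g (places N - {p}) = m \<and> restrict g (places N) \<in> reachable N"
    if "m \<in> reachable ?M" for m
    using that
  proof (induction rule: reachable.induct)
    case initial
    then show ?case using reachable.initial[of N] by (auto simp del: restrict_apply)
  next
    case (step m t)
    then obtain g where g: "restrict g (places N - {p}) = m" "restrict g (places N) \<in> reachable N"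
      by blast
    have t: "t \<in> transitions N" "\<And>q. q \<in> places N - {p} \<Longrightarrow> pre N t q \<le> g q"
      using step g(1) by (auto simp: enabled_def)
    \<comment> \<open>The hurdle condition bounds the demand on \<open>p\<close> by the demand on
      \<open>I\<close> plus \<open>b\<close>. The places of \<open>I\<close> survive the removal and
      meet their demand, and the invariant turns the bound into \<open>v p * g p\<close>.\<close>
    have "int (v p) * int (pre N t p) \<le> (\<Sum>q\<in>I. int (v q) * int (pre N t q)) + int b"
      using hurdle[OF t(1)] by simp
    also have "\<dots> \<le> (\<Sum>q\<in>I. int (v q) * int (restrict g (places N) q)) + int b"
      using t(2) I by (intro add_right_mono sum_mono mult_left_mono) auto
    also have "\<dots> = int (v p) * int (g p)" using sound[OF g(2)] p by simp
    finally have "pre N t p \<le> g p" using p(2) by simp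
    then have enab: "pre N t q \<le> g q" if "q \<in> places N" for q using t(2)[of q] that by auto
    let ?g = "\<lambda>q. g q - pre N t q + post N t q"
    have "restrict ?g (places N) \<in> reachable N"
      by (rule reachable_fire_restrict[OF g(2) t(1)]) (use enab in auto)
    moreover have "restrict ?g (places N - {p}) = fire ?M m t"
      using g(1) by (auto simp: fire_def)
    ultimately show ?case by blast
  qed
  have invariant: "v p * g p = (\<Sum>q\<in>I. v q * g q) + b" if "restrict g (places N) \<in> reachable N" for g
  proof -
    have "(\<Sum>q\<in>I. int (v q) * int (restrict g (places N) q)) = (\<Sum>q\<in>I. int (v q) * int (g q))"
      using I by (intro sum.cong) auto
    then have "int (v p * g p) = int ((\<Sum>q\<in>I. v q * g q) + b)" using sound[OF that] p by simp
    then show ?thesis by (simp only: of_nat_eq_iff)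
  qed
  show ?thesis
  proof
    assume f: "restrict f (places N) \<in> reachable N"
    have "restrict (restrict f (places N)) (places N - {p}) = restrict f (places N - {p})"
      by (auto simp: restrict_def)
    then show "restrict f (places N - {p}) \<in> reachable ?M \<and> v p * f p = (\<Sum>q\<in>I. v q * f q) + b"
      using sound[OF f] invariant[OF f] by simp
  next
    assume f: "restrict f (places N - {p}) \<in> reachable ?M \<and> v p * f p = (\<Sum>q\<in>I. v q * f q) + b"
    then obtain g where g: "restrict g (places N - {p}) = restrict f (places N - {p})"
      "restrict g (places N) \<in> reachable N" using complete by blast
    have eq: "g q = f q" if "q \<in> places N - {p}" for q using restrict_eqD[OF g(1) that] .
    \<comment> \<open>\<open>f\<close> and \<open>g\<close> satisfy the same equation with the same
      right-hand side, and \<open>v p\<close> is non-zero, so they agree on \<open>p\<close>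
      too.\<close>
    have "(\<Sum>q\<in>I. v q * g q) = (\<Sum>q\<in>I. v q * f q)" using eq I by (intro sum.cong) auto
    then have "v p * g p = v p * f p" using invariant[OF g(2)] f by simp
    then have "g p = f p" using p(2) by simp
    then have "restrict g (places N) = restrict f (places N)" using eq by (auto simp: restrict_def fun_eq_iff)
    then show "restrict f (places N) \<in> reachable N" using g(2) by simp
  qed
qed

section \<open>Agglomerations\<close>

lemma agglomerate_simps [simp]:
  "places (agglomerate N A a) = insert a (places N - A)"
  "transitions (agglomerate N A a) = transitions N"
  "pre (agglomerate N A a) t = (pre N t)(a := \<Sum>r\<in>A. pre N t r)"
  "post (agglomerate N A a) t = (post N t)(a := \<Sum>r\<in>A. post N t r)"
  "init (agglomerate N A a) = (init N)(a := \<Sum>r\<in>A. init N r)"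
  by (simp_all add: agglomerate_def)

text \<open>Adding up the tokens of \<open>A\<close> commutes with firing: truncated subtraction
  distributes over the sum because each place of \<open>A\<close> meets its own demand.\<close>

lemma reachable_agglomerate:
  assumes "A \<subseteq> places N" "a \<notin> places N" "restrict f (places N) \<in> reachable N"
    and "f a = (\<Sum>r\<in>A. f r)"
  shows "restrict f (insert a (places N - A)) \<in> reachable (agglomerate N A a)"
proof -
  let ?M = "agglomerate N A a"
  have "restrict (m(a := \<Sum>r\<in>A. m r)) (places ?M) \<in> reachable ?M" if "m \<in> reachable N" for m
    using that
  proof (induction rule: reachable.induct)
    case initial
    have "(\<Sum>r\<in>A. restrict (init N) (places N) r) = (\<Sum>r\<in>A. init N r)"
      using assms(1) by (intro sum.cong) auto
    then have "restrict ((restrict (init N) (places N))(a := \<Sum>r\<in>A. restrict (init N) (places N) r))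
        (places ?M) = restrict (init ?M) (places ?M)"
      using assms(2) by (auto simp: restrict_def)
    then show ?case using reachable.initial[of ?M] by metis
  next
    case (step m t)
    have t: "t \<in> transitions N" "\<And>q. q \<in> places N \<Longrightarrow> pre N t q \<le> m q"
      using step by (auto simp: enabled_def)
    have le: "(\<Sum>r\<in>A. pre N t r) \<le> (\<Sum>r\<in>A. m r)" using t(2) assms(1) by (auto intro: sum_mono)
    have "(\<Sum>r\<in>A. fire N m t r) = (\<Sum>r\<in>A. m r - pre N t r + post N t r)"
      using assms(1) by (intro sum.cong) (auto simp: fire_def)
    also have "\<dots> = (\<Sum>r\<in>A. m r) - (\<Sum>r\<in>A. pre N t r) + (\<Sum>r\<in>A. post N t r)"
      using t(2) assms(1) by (simp only: sum.distrib) (simp add: sum_subtractf_nat subset_iff)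
    finally have sum: "(\<Sum>r\<in>A. fire N m t r) =
      (\<Sum>r\<in>A. m r) - (\<Sum>r\<in>A. pre N t r) + (\<Sum>r\<in>A. post N t r)" .
    show ?case
    proof (rule reachable_fire_restrict[OF step.IH, of t])
      show "((fire N m t)(a := \<Sum>r\<in>A. fire N m t r)) r =
          (m(a := \<Sum>r\<in>A. m r)) r - pre ?M t r + post ?M t r" if "r \<in> places ?M" for r
        using that sum by (auto simp: fire_def)
    qed (use t le in auto)
  qed
  from this[OF assms(3)]
  have "restrict ((restrict f (places N))(a := \<Sum>r\<in>A. restrict f (places N) r)) (places ?M)
      \<in> reachable ?M" .
  moreover have "(\<Sum>r\<in>A. restrict f (places N) r) = (\<Sum>r\<in>A. f r)"
    using assms(1) by (intro sum.cong) auto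
  ultimately have "restrict ((restrict f (places N))(a := f a)) (places ?M) \<in> reachable ?M"
    using assms(4) by simp
  moreover have "restrict ((restrict f (places N))(a := f a)) (places ?M) =
      restrict f (insert a (places N - A))"
    by (auto simp: restrict_def)
  ultimately show ?thesis by simp
qed

text \<open>The fresh variable \<open>a\<close> is unconstrained by \<open>Q\<close>, so the new equation only defines it.\<close>

lemma net_abstraction_agglomerate:
  assumes abs: "net_abstraction N\<^sub>1 Q N\<^sub>2" and A: "A \<subseteq> places N\<^sub>2"
    and a: "a \<notin> system_vars Q" "a \<notin> places N\<^sub>1" "a \<notin> places N\<^sub>2"
    and complete: "\<And>f. restrict f (insert a (places N\<^sub>2 - A)) \<in> reachable (agglomerate N\<^sub>2 A a) \<Longrightarrow>
      f a = (\<Sum>r\<in>A. f r) \<Longrightarrow> restrict f (places N\<^sub>2) \<in> reachable N\<^sub>2"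
  shows "net_abstraction N\<^sub>1 (Q @ [Eq (term_expr 1 a) (affine_expr A (\<lambda>_. 1) 0)])
    (agglomerate N\<^sub>2 A a)"
proof -
  let ?M = "agglomerate N\<^sub>2 A a"
  have N: "petri_net N\<^sub>1" "petri_net N\<^sub>2"
    and R: "reachable N\<^sub>1 = {restrict f (places N\<^sub>1) | f.
      restrict f (places N\<^sub>2) \<in> reachable N\<^sub>2 \<and> (\<forall>c\<in>set Q. satisfies f c)}"
    using abs unfolding net_abstraction_iff by auto
  have finA: "finite A" using N(2) A finite_subset by (auto simp: petri_net_def)
  have M: "petri_net ?M" using N by (auto simp: petri_net_def)
  have eq: "satisfies f (Eq (term_expr 1 a) (affine_expr A (\<lambda>_. 1) 0)) \<longleftrightarrow> f a = (\<Sum>r\<in>A. f r)" for f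
  proof -
    have "satisfies f (Eq (term_expr 1 a) (affine_expr A (\<lambda>_. 1) 0)) \<longleftrightarrow>
        int (f a) = int (\<Sum>r\<in>A. f r)"
      using finA by (simp add: expr_val_term_expr expr_val_affine_expr)
    then show ?thesis by (simp only: of_nat_eq_iff)
  qed
  have "\<exists>g. restrict f (places N\<^sub>1) = restrict g (places N\<^sub>1) \<and>
      restrict g (places ?M) \<in> reachable ?M \<and> (\<forall>c\<in>set Q. satisfies g c) \<and> g a = (\<Sum>r\<in>A. g r)"
    if f: "restrict f (places N\<^sub>2) \<in> reachable N\<^sub>2" "\<forall>c\<in>set Q. satisfies f c" for f
  proof -
    \<comment> \<open>Only the value at \<open>a\<close> changes. As \<open>a\<close> is fresh,
      neither the two markings nor the truth of \<open>Q\<close> is affected.\<close>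
    let ?g = "f(a := \<Sum>r\<in>A. f r)"
    have sum: "?g a = (\<Sum>r\<in>A. ?g r)" using A a(3) by (auto intro!: sum.cong)
    have "restrict ?g (places N\<^sub>1) = restrict f (places N\<^sub>1)"
      "restrict ?g (places N\<^sub>2) = restrict f (places N\<^sub>2)"
      using a by (auto simp: restrict_def)
    moreover have "satisfies ?g c" if "c \<in> set Q" for c
    proof -
      have "satisfies ?g c \<longleftrightarrow> satisfies f c"
        by (rule satisfies_cong) (use that a(1) in \<open>auto simp: system_vars_def\<close>)
      then show ?thesis using f(2) that by simp
    qed
    moreover have "restrict ?g (insert a (places N\<^sub>2 - A)) \<in> reachable ?M"
      using reachable_agglomerate[OF A a(3), of ?g] sum f(1) calculation(2) by argo
    ultimately show ?thesis using sum by (intro exI[of _ ?g]) (simp only: agglomerate_simps, blast)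
  qed
  then have "reachable N\<^sub>1 = {restrict f (places N\<^sub>1) | f. restrict f (places ?M) \<in> reachable ?M \<and>
      (\<forall>c\<in>set Q. satisfies f c) \<and> f a = (\<Sum>r\<in>A. f r)}"
    unfolding R using complete by (auto; metis)
  then show ?thesis
    unfolding net_abstraction_iff using N M by (simp add: eq[simplified] conj_ac)
qed

section \<open>Moving tokens inside an agglomerated set\<close>

definition move :: "'v \<Rightarrow> 'v \<Rightarrow> ('v \<Rightarrow> nat) \<Rightarrow> 'v \<Rightarrow> nat" where
  "move r s f = (\<lambda>x. f x - (if x = r then 1 else 0) + (if x = s then 1 else 0))"

text \<open>Induction on the surplus of \<open>f\<close> over \<open>g\<close> on \<open>A\<close>.
  Since the totals agree, a difference means that some \<open>r\<close> has too many tokens and some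
  \<open>s\<close> too few, and one token is moved from \<open>r\<close> to
  \<open>s\<close>.\<close>

lemma redistribute_reachable:
  assumes A: "finite A" "A \<subseteq> places N"
    and moves: "\<And>f r s. restrict f (places N) \<in> reachable N \<Longrightarrow> r \<in> A \<Longrightarrow> s \<in> A \<Longrightarrow> r \<noteq> s \<Longrightarrow>
      0 < f r \<Longrightarrow> restrict (move r s f) (places N) \<in> reachable N"
    and f: "restrict f (places N) \<in> reachable N"
    and outside: "\<And>q. q \<in> places N - A \<Longrightarrow> g q = f q"
    and sum: "(\<Sum>r\<in>A. f r) = (\<Sum>r\<in>A. g r)"
  shows "restrict g (places N) \<in> reachable N"
  using f outside sum
proof (induction "\<Sum>r\<in>A. f r - g r" arbitrary: f rule: less_induct)
  case less
  show ?case
  proof (cases "\<exists>r\<in>A. f r \<noteq> g r")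
    case False
    then have "restrict g (places N) = restrict f (places N)"
      using less.prems(2) by (auto simp: restrict_def fun_eq_iff) (metis DiffI)
    then show ?thesis using less.prems(1) by simp
  next
    case True
    have "\<exists>r\<in>A. g r < f r"
    proof (rule ccontr)
      assume "\<not> (\<exists>r\<in>A. g r < f r)"
      then have "sum f A < sum g A"
        using True A(1) by (intro sum_strict_mono_ex1) (auto simp: not_less le_less)
      then show False using less.prems(3) by simp
    qed
    moreover have "\<exists>s\<in>A. f s < g s"
    proof (rule ccontr)
      assume "\<not> (\<exists>s\<in>A. f s < g s)"
      then have "sum g A < sum f A"
        using True A(1) by (intro sum_strict_mono_ex1) (auto simp: not_less le_less)
      then show False using less.prems(3) by simp
    qed
    ultimately obtain r s where rs: "r \<in> A" "s \<in> A" "g r < f r" "f s < g s" by blast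
    let ?f = "move r s f"
    have "(\<Sum>x\<in>A. ?f x) + (\<Sum>x\<in>A. if x = r then 1 else 0) =
        (\<Sum>x\<in>A. f x) + (\<Sum>x\<in>A. if x = s then 1 else 0)"
      using rs by (simp only: sum.distrib[symmetric]) (auto intro!: sum.cong simp: move_def)
    then have "(\<Sum>x\<in>A. ?f x) = (\<Sum>x\<in>A. f x)" using A(1) rs by simp
    \<comment> \<open>The surplus on \<open>r\<close> drops by one; on \<open>s\<close> it stays 0
      because \<open>f s < g s\<close>.\<close>
    moreover have "(\<Sum>x\<in>A. ?f x - g x) < (\<Sum>x\<in>A. f x - g x)"
      using rs A(1) by (intro sum_strict_mono_ex1) (auto simp: move_def intro!: bexI[of _ r])
    moreover have "restrict ?f (places N) \<in> reachable N"
      using rs by (intro moves less.prems) auto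
    moreover have "g q = ?f q" if "q \<in> places N - A" for q
      using less.prems(2)[OF that] that rs by (auto simp: move_def)
    ultimately show ?thesis using less.hyps[of ?f] less.prems(3) by simp
  qed
qed

text \<open>Provides a distribution of \<open>n\<close> tokens that covers the demand
  \<open>h\<close> of a transition; the excess goes to an arbitrary place \<open>s\<close>.\<close>

lemma exists_sum_eq:
  fixes h :: "'a \<Rightarrow> nat"
  assumes "finite A" "A \<noteq> {}" "(\<Sum>r\<in>A. h r) \<le> n"
  shows "\<exists>g. (\<forall>r\<in>A. h r \<le> g r) \<and> (\<Sum>r\<in>A. g r) = n"
proof -
  obtain s where s: "s \<in> A" using assms by auto
  define g where "g = h(s := h s + (n - sum h A))"
  have "sum g A = g s + sum g (A - {s})" using assms s by (simp add: sum.remove)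
  also have "sum g (A - {s}) = sum h (A - {s})" by (intro sum.cong) (auto simp: g_def)
  also have "g s + \<dots> = sum h A + (n - sum h A)"
    using assms s by (simp add: sum.remove[of A s h] g_def)
  finally show ?thesis using assms by (intro exI[of _ g]) (auto simp: g_def)
qed

text \<open>Each reachable marking of the agglomerated net is realised by some distribution of the
  tokens of \<open>a\<close> over \<open>A\<close>. Before a firing the tokens are redistributed to
  suit the transition, and at the end to match \<open>f\<close>.\<close>

lemma reachable_agglomerate_of_moves:
  assumes A: "finite A" "A \<subseteq> places N" and a: "a \<notin> places N"
    and moves: "\<And>f r s. restrict f (places N) \<in> reachable N \<Longrightarrow> r \<in> A \<Longrightarrow> s \<in> A \<Longrightarrow> r \<noteq> s \<Longrightarrow>
      0 < f r \<Longrightarrow> restrict (move r s f) (places N) \<in> reachable N"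
    and f: "restrict f (insert a (places N - A)) \<in> reachable (agglomerate N A a)"
      "f a = (\<Sum>r\<in>A. f r)"
  shows "restrict f (places N) \<in> reachable N"
proof -
  let ?M = "agglomerate N A a"
  note redistribute = redistribute_reachable[OF A moves]
  have "\<exists>g. m = restrict g (places ?M) \<and> g a = (\<Sum>r\<in>A. g r) \<and> restrict g (places N) \<in> reachable N"
    if "m \<in> reachable ?M" for m
    using that
  proof (induction rule: reachable.induct)
    case initial
    \<comment> \<open>\<open>init ?M\<close> differs from \<open>init N\<close> at \<open>a\<close>
      only, so it still holds the original distribution on \<open>A\<close> and is itself the
      witness.\<close>
    have "restrict (init ?M) (places N) = restrict (init N) (places N)"
      using a by (auto simp: restrict_def)
    moreover have "init ?M a = (\<Sum>r\<in>A. init ?M r)"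
      using A a by (auto intro!: sum.cong)
    ultimately show ?case using reachable.initial[of N] by metis
  next
    case (step m t)
    then obtain g where g: "m = restrict g (places ?M)" "g a = (\<Sum>r\<in>A. g r)"
      "restrict g (places N) \<in> reachable N" by blast
    have t: "t \<in> transitions N" "\<And>q. q \<in> places N - A \<Longrightarrow> pre N t q \<le> g q"
      "(\<Sum>r\<in>A. pre N t r) \<le> g a"
    proof -
      have le: "pre ?M t q \<le> g q" if "q \<in> places ?M" for q
        using step.hyps(2) that unfolding g(1) enabled_def by (metis restrict_apply')
      show "(\<Sum>r\<in>A. pre N t r) \<le> g a" using le[of a] by simp
      show "pre N t q \<le> g q" if "q \<in> places N - A" for q
        using le[of q] that a by (auto split: if_splits)
      show "t \<in> transitions N" using step.hyps(2) by (simp add: enabled_def)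
    qed
    \<comment> \<open>Enabledness at \<open>a\<close> only bounds the total demand, so a
      distribution \<open>h\<close> meeting the demand of each place is chosen. For empty
      \<open>A\<close> both sums are 0.\<close>
    have "\<exists>h. (\<forall>r\<in>A. pre N t r \<le> h r) \<and> (\<Sum>r\<in>A. h r) = g a"
      using exists_sum_eq[OF A(1) _ t(3)] g(2) by (cases "A = {}") auto
    then obtain h where h: "\<And>r. r \<in> A \<Longrightarrow> pre N t r \<le> h r" "(\<Sum>r\<in>A. h r) = g a" by auto
    \<comment> \<open>\<open>g1\<close> is \<open>g\<close> with its tokens on \<open>A\<close>
      rearranged as \<open>h\<close>; it is reachable by redistribution and enables \<open>t\<close>
      in \<open>N\<close>.\<close>
    define g1 where "g1 = (\<lambda>x. if x \<in> A then h x else g x)"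
    have sum1: "(\<Sum>r\<in>A. g1 r) = g a" using h(2) by (simp add: g1_def cong: sum.cong)
    have g1: "restrict g1 (places N) \<in> reachable N"
      by (rule redistribute[OF _ _ _ _ _ g(3)]) (use sum1 g(2) in \<open>auto simp: g1_def\<close>)
    define g2 where "g2 = (\<lambda>x. g1 x - pre ?M t x + post ?M t x)"
    have "restrict g2 (places N) \<in> reachable N"
      by (rule reachable_fire_restrict[OF g1 t(1)])
        (use t h a A in \<open>auto simp: g1_def g2_def\<close>)
    moreover have "g2 a = (\<Sum>r\<in>A. g2 r)"
    proof -
      have "(\<Sum>r\<in>A. g2 r) = (\<Sum>r\<in>A. h r - pre N t r + post N t r)"
        using A(2) a by (intro sum.cong) (auto simp: g1_def g2_def)
      also have "\<dots> = (\<Sum>r\<in>A. h r) - (\<Sum>r\<in>A. pre N t r) + (\<Sum>r\<in>A. post N t r)"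
        using h(1) by (simp only: sum.distrib) (simp add: sum_subtractf_nat)
      also have "\<dots> = g2 a" using h(2) A(2) a by (auto simp: g2_def g1_def)
      finally show ?thesis by simp
    qed
    moreover have "fire ?M m t = restrict g2 (places ?M)"
      using A(2) a by (auto simp: fire_def g(1) g2_def g1_def intro!: restrict_ext)
    ultimately show ?case by blast
  qed
  then obtain g where g: "restrict f (places ?M) = restrict g (places ?M)" "g a = (\<Sum>r\<in>A. g r)"
    "restrict g (places N) \<in> reachable N" using f(1) by auto
  have eq: "f q = g q" if "q \<in> insert a (places N - A)" for q
    using restrict_eqD[OF g(1)] that by simp
  show ?thesis
    by (rule redistribute[OF _ _ _ _ _ g(3)]) (use eq f(2) g(2) in auto)
qed

text \<open>Following the cycle for \<open>k\<close> steps carries a token from one place of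
  \<open>A\<close> to any other, which supplies the moves required above.\<close>

lemma reachable_agglomerate_loop:
  assumes loop: "loop_agglomerable N A" and a: "a \<notin> places N"
    and f: "restrict f (insert a (places N - A)) \<in> reachable (agglomerate N A a)"
      "f a = (\<Sum>r\<in>A. f r)"
  shows "restrict f (places N) \<in> reachable N"
proof -
  from loop obtain n :: nat and \<pi> where A: "A = \<pi> ` {..<n}" "A \<subseteq> places N"
    and trans: "\<And>i. i < n \<Longrightarrow> \<exists>t\<in>transitions N. \<forall>r\<in>places N.
      pre N t r = (if r = \<pi> i then 1 else 0) \<and>
      post N t r = (if r = \<pi> ((i + 1) mod n) then 1 else 0)"
    unfolding loop_agglomerable_def by blast
  have moves: "restrict (move (\<pi> i) (\<pi> ((i + k) mod n)) g) (places N) \<in> reachable N"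
    if "restrict g (places N) \<in> reachable N" "i < n" "0 < g (\<pi> i)" for g i k
  proof (induction k)
    case 0
    \<comment> \<open>\<open>move\<close> subtracts before it adds, so it is the identity here only
      because \<open>\<pi> i\<close> holds a token.\<close>
    have "move (\<pi> i) (\<pi> i) g = g" using that(3) by (auto simp: move_def)
    then show ?case using that by (simp add: restrict_def)
  next
    case (Suc k)
    define j where "j = (i + k) mod n"
    have j: "j < n" "(i + Suc k) mod n = (j + 1) mod n"
      using that(2) by (auto simp: j_def mod_simps)
    then obtain t where t: "t \<in> transitions N"
      "\<And>r. r \<in> places N \<Longrightarrow> pre N t r = (if r = \<pi> j then 1 else 0)"
      "\<And>r. r \<in> places N \<Longrightarrow> post N t r = (if r = \<pi> ((j + 1) mod n) then 1 else 0)"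
      using trans by metis
    \<comment> \<open>The token carried so far lies on \<open>\<pi> j\<close>, so the next
      transition of the cycle is enabled.\<close>
    show ?case unfolding j(2)
      by (rule reachable_fire_restrict[OF Suc t(1), folded j_def])
        (use t that(3) in \<open>auto simp: move_def\<close>)
  qed
  show ?thesis
  proof (rule reachable_agglomerate_of_moves[OF _ A(2) a _ f])
    fix g r s
    assume g: "restrict g (places N) \<in> reachable N" "r \<in> A" "s \<in> A" "0 < g r"
    then obtain i j where ij: "i < n" "j < n" "r = \<pi> i" "s = \<pi> j" using A(1) by auto
    \<comment> \<open>Going past the end of the cycle to index 0 and then on to \<open>j\<close>
      avoids comparing \<open>i\<close> with \<open>j\<close>.\<close>
    have "(i + (n - i + j)) mod n = j" using ij by simp
    then show "restrict (move r s g) (places N) \<in> reachable N"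
      using moves[OF g(1) ij(1), of "n - i + j"] g(4) ij by simp
  qed (simp add: A(1))
qed

text \<open>
  Invariant for \<open>p \<noteq> q\<close>: each marking of the agglomerated net is realised with all tokens of
  \<open>a\<close> on \<open>p\<close>.  Before another transition fires, exactly the tokens it needs on \<open>q\<close> are moved there.
  For \<open>p = q\<close> agglomeration only renames the place.
\<close>

lemma reachable_agglomerate_chain:
  assumes chain: "chain_agglomerable N A" and a: "a \<notin> places N"
    and f: "restrict f (insert a (places N - A)) \<in> reachable (agglomerate N A a)"
      "f a = (\<Sum>r\<in>A. f r)"
  shows "restrict f (places N) \<in> reachable N"
proof -
  let ?M = "agglomerate N A a"
  from chain obtain p q t where pq: "p \<in> places N" "q \<in> places N" "A = {p, q}"
    and t: "t \<in> transitions N" "preset_trans N t = {p}" "postset_trans N t = {q}"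
      "pre N t p = 1" "post N t q = 1"
    and q: "preset_place N q = {t}" "init N q = 0"
    unfolding chain_agglomerable_def by blast
  show ?thesis
  proof (cases "p = q")
    case True
    \<comment> \<open>\<open>A\<close> is a singleton, so there are no distinct places to move
      between.\<close>
    show ?thesis
      by (rule reachable_agglomerate_of_moves[OF _ _ a _ f]) (use pq True in auto)
  next
    case False
    have pq_a: "p \<noteq> a" "q \<noteq> a" using pq a by auto
    have pre_t: "pre N t r = (if r = p then 1 else 0)"
      and post_t: "post N t r = (if r = q then 1 else 0)" if "r \<in> places N" for r
      using t that by (auto simp: preset_trans_def postset_trans_def)
    have post_q: "post N u q = 0" if "u \<in> transitions N" "u \<noteq> t" for u
    proof (rule ccontr)
      assume "post N u q \<noteq> 0"
      then have "u \<in> preset_place N q" using that(1) by (simp add: preset_place_def)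
      then show False using q(1) that(2) by blast
    qed
    \<comment> \<open>Firing \<open>t\<close> repeatedly, \<open>k\<close> times in all, carries
      \<open>k\<close> tokens from \<open>p\<close> to \<open>q\<close>.\<close>
    have moves: "restrict (g(p := g p - k, q := g q + k)) (places N) \<in> reachable N"
      if "restrict g (places N) \<in> reachable N" "k \<le> g p" for g k
      using that(2)
    proof (induction k)
      case 0
      then show ?case using that by (simp add: restrict_def)
    next
      case (Suc k)
      then have "restrict (g(p := g p - k, q := g q + k)) (places N) \<in> reachable N"
        by (intro Suc.IH) (use Suc.prems in simp)
      then show ?case
        by (rule reachable_fire_restrict[OF _ t(1)]) (use Suc.prems False pre_t post_t in auto)
    qed
    have "restrict (m(p := m a, q := 0)) (places N) \<in> reachable N" if "m \<in> reachable ?M" for m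
      using that
    proof (induction rule: reachable.induct)
      case initial
      \<comment> \<open>\<open>q\<close> is initially empty, so the tokens of \<open>a\<close> are
        exactly those of \<open>p\<close>.\<close>
      have "restrict ((restrict (init ?M) (places ?M))(p := restrict (init ?M) (places ?M) a, q := 0))
          (places N) = restrict (init N) (places N)"
        using pq q(2) False a by (auto simp: restrict_def)
      then show ?case using reachable.initial[of N] by metis
    next
      case (step m u)
      have u: "u \<in> transitions N" "\<And>r. r \<in> places N - A \<Longrightarrow> pre N u r \<le> m r"
        "pre N u p + pre N u q \<le> m a"
      proof -
        have le: "pre ?M u r \<le> m r" if "r \<in> places ?M" for r
          using step.hyps(2) that unfolding enabled_def by blast
        show "pre N u p + pre N u q \<le> m a" using le[of a] pq(3) False by simp
        show "pre N u r \<le> m r" if "r \<in> places N - A" for r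
          using le[of r] that a by (auto split: if_splits)
        show "u \<in> transitions N" using step.hyps(2) by (simp add: enabled_def)
      qed
      show ?case
      proof (cases "u = t")
        case True
        \<comment> \<open>In the agglomerated net \<open>t\<close> takes a token from
          \<open>a\<close> and puts it back, so \<open>N\<close> need not fire at all.\<close>
        have "restrict ((fire ?M m u)(p := fire ?M m u a, q := 0)) (places N) =
            restrict (m(p := m a, q := 0)) (places N)"
          using pre_t post_t pq pq_a True False u(3) a
          by (auto simp: fire_def restrict_def)
        then show ?thesis using step.IH by metis
      next
        case False
        let ?g = "m(p := m a, q := 0)"
        have "restrict (?g(p := ?g p - pre N u q, q := ?g q + pre N u q)) (places N) \<in> reachable N"
          by (rule moves[OF step.IH]) (use u(3) \<open>p \<noteq> q\<close> in auto)
        \<comment> \<open>\<open>u\<close> consumes all tokens just moved to \<open>q\<close> and,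
          being different from \<open>t\<close>, puts none there; \<open>q\<close> is empty
          again.\<close>
        then show ?thesis
          by (rule reachable_fire_restrict[OF _ u(1)])
            (use u pq pq_a \<open>p \<noteq> q\<close> post_q[OF u(1) False] a in \<open>auto simp: fire_def\<close>)
      qed
    qed
    from this[OF f(1)] have "restrict ((restrict f (insert a (places N - A)))
        (p := restrict f (insert a (places N - A)) a, q := 0)) (places N) \<in> reachable N" .
    also have "restrict ((restrict f (insert a (places N - A)))
        (p := restrict f (insert a (places N - A)) a, q := 0)) (places N) =
      restrict (f(p := f a, q := 0)) (places N)"
      using pq by (auto simp: restrict_def)
    finally have "restrict (f(p := f a, q := 0)) (places N) \<in> reachable N" .
    \<comment> \<open>All \<open>f p + f q\<close> tokens are on \<open>p\<close>; moving
      \<open>f q\<close> of them yields the distribution of \<open>f\<close>.\<close>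
    from moves[OF this, of "f q"] f(2) False pq(3)
    have "restrict ((f(p := f a, q := 0))(p := f p, q := f q)) (places N) \<in> reachable N"
      by simp
    then show ?thesis using False by (simp add: fun_upd_twist)
  qed
qed

section \<open>Source-sink pairs\<close>

lemma remove_source_sink_pair_simps [simp]:
  "places (remove_source_sink_pair N p t) = places N - {p}"
  "transitions (remove_source_sink_pair N p t) = transitions N - {t}"
  "pre (remove_source_sink_pair N p t) = pre N"
  "post (remove_source_sink_pair N p t) = post N"
  "init (remove_source_sink_pair N p t) = init N"
  by (simp_all add: remove_source_sink_pair_def)

text \<open>No transition feeds \<open>p\<close>, only \<open>t\<close> consumes from it, and
  \<open>t\<close> touches no other place. Hence the rest of the net evolves independently of
  \<open>p\<close>.\<close>

lemma reachable_remove_source_sink_pair: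
  assumes "source_sink_pair N p t"
  shows "restrict f (places N) \<in> reachable N \<longleftrightarrow>
    restrict f (places N - {p}) \<in> reachable (remove_source_sink_pair N p t) \<and> f p \<le> init N p"
proof -
  let ?M = "remove_source_sink_pair N p t"
  have p: "p \<in> places N" and t: "t \<in> transitions N"
    and t_eff: "\<And>r. r \<in> places N \<Longrightarrow> pre N t r = (if r = p then 1 else 0) \<and> post N t r = 0"
    and post_p: "\<And>u. u \<in> transitions N \<Longrightarrow> post N u p = 0"
    and pre_p: "\<And>u. u \<in> transitions N \<Longrightarrow> u \<noteq> t \<Longrightarrow> pre N u p = 0"
    using assms by (auto simp: source_sink_pair_def preset_place_def postset_place_def)
  have sound: "restrict m (places ?M) \<in> reachable ?M \<and> m p \<le> init N p" if "m \<in> reachable N" for m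
    using that
  proof (induction rule: reachable.induct)
    case initial
    have "restrict (restrict (init N) (places N)) (places ?M) = restrict (init ?M) (places ?M)"
      by (auto simp: restrict_def)
    then show ?case using reachable.initial[of ?M] p by (simp add: restrict_def)
  next
    case (step m u)
    have u: "u \<in> transitions N" "\<And>q. q \<in> places N \<Longrightarrow> pre N u q \<le> m q"
      using step by (auto simp: enabled_def)
    have "m p \<le> init N p" using step.IH by blast
    then have "fire N m u p \<le> init N p" using p post_p[OF u(1)] by (simp add: fire_def)
    moreover have "restrict (fire N m u) (places ?M) \<in> reachable ?M"
    proof (cases "u = t")
      case True
      then have "restrict (fire N m u) (places ?M) = restrict m (places ?M)"
        using t_eff by (auto simp: fire_def restrict_def)
      then show ?thesis using step by metis
    next
      case False
      show ?thesis
      proof (rule reachable_fire_restrict[of m _ u])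
        show "restrict m (places ?M) \<in> reachable ?M" using step.IH by blast
      qed (use u False in \<open>auto simp: fire_def\<close>)
    qed
    ultimately show ?case by (simp del: restrict_apply)
  qed
  \<comment> \<open>Runs of the reduced net are replayed with \<open>p\<close> kept at its initial
    value; all firings of \<open>t\<close> are postponed to the end.\<close>
  have complete: "restrict (m(p := init N p)) (places N) \<in> reachable N" if "m \<in> reachable ?M" for m
    using that
  proof (induction rule: reachable.induct)
    case initial
    have "restrict ((restrict (init ?M) (places ?M))(p := init N p)) (places N) =
        restrict (init N) (places N)"
      by (auto simp: restrict_def)
    then show ?case using reachable.initial[of N] by metis
  next
    case (step m u)
    then have u: "u \<in> transitions N" "u \<noteq> t" "\<And>q. q \<in> places N - {p} \<Longrightarrow> pre N u q \<le> m q"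
      by (auto simp: enabled_def)
    show ?case
      by (rule reachable_fire_restrict[OF step.IH u(1)])
        (use u(3) post_p[OF u(1)] pre_p[OF u(1,2)] in \<open>auto simp: fire_def\<close>)
  qed
  have drain: "restrict (g(p := g p - k)) (places N) \<in> reachable N"
    if "restrict g (places N) \<in> reachable N" "k \<le> g p" for g k
    using that(2)
  proof (induction k)
    case 0
    then show ?case using that by (simp add: restrict_def)
  next
    case (Suc k)
    then have "restrict (g(p := g p - k)) (places N) \<in> reachable N"
      by (intro Suc.IH) (use Suc.prems in simp)
    then show ?case
      by (rule reachable_fire_restrict[OF _ t]) (use Suc.prems t_eff in auto)
  qed
  show ?thesis
  proof
    assume f: "restrict f (places N) \<in> reachable N"
    have "restrict (restrict f (places N)) (places ?M) = restrict f (places N - {p})"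
      by (auto simp: restrict_def)
    then show "restrict f (places N - {p}) \<in> reachable ?M \<and> f p \<le> init N p"
      using sound[OF f] p by simp
  next
    assume f: "restrict f (places N - {p}) \<in> reachable ?M \<and> f p \<le> init N p"
    have "restrict ((restrict f (places N - {p}))(p := init N p)) (places N) =
        restrict (f(p := init N p)) (places N)"
      by (auto simp: restrict_def)
    then have "restrict (f(p := init N p)) (places N) \<in> reachable N"
      using complete f by metis
    \<comment> \<open>These firings of \<open>t\<close> bring \<open>p\<close> from
      \<open>init N p\<close> down to \<open>f p\<close>.\<close>
    from drain[OF this, of "init N p - f p"] show "restrict f (places N) \<in> reachable N"
      using f by simp
  qed
qed

section \<open>Assembling the five cases\<close>

theorem theorem5:
  fixes N :: "('v, 'r) net" and N\<^sub>1 :: "('v, 's) net" and N\<^sub>2 :: "('v, 't) net"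
    and Q :: "'v lin_system"
  assumes "petri_net N" and "petri_net N\<^sub>1" and "petri_net N\<^sub>2"
  shows "net_abstraction N [] N \<and>
    (net_abstraction N\<^sub>1 Q N\<^sub>2 \<longrightarrow>
      (\<forall>t. redundant_transition N\<^sub>2 t \<longrightarrow>
         net_abstraction N\<^sub>1 Q (remove_transition N\<^sub>2 t)) \<and>
      (\<forall>p I v b. redundant_place N\<^sub>2 p I v b \<longrightarrow>
         net_abstraction N\<^sub>1 (Q @ [Eq (term_expr (v p) p) (affine_expr I v b)])
           (remove_place N\<^sub>2 p)) \<and>
      (\<forall>A a. (chain_agglomerable N\<^sub>2 A \<or> loop_agglomerable N\<^sub>2 A) \<and>
         a \<notin> system_vars Q \<and> a \<notin> places N\<^sub>1 \<and> a \<notin> places N\<^sub>2 \<longrightarrow>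
         net_abstraction N\<^sub>1 (Q @ [Eq (term_expr 1 a) (affine_expr A (\<lambda>_. 1) 0)])
           (agglomerate N\<^sub>2 A a)) \<and>
      (\<forall>p t k. source_sink_pair N\<^sub>2 p t \<and> init N\<^sub>2 p = k \<longrightarrow>
         net_abstraction N\<^sub>1 (Q @ [Le (term_expr 1 p) (affine_expr {} (\<lambda>_. 0) k)])
           (remove_source_sink_pair N\<^sub>2 p t)))"
proof (intro conjI impI allI)
  show "net_abstraction N [] N" using net_abstraction_refl assms(1) .
next
  fix t
  assume "net_abstraction N\<^sub>1 Q N\<^sub>2" "redundant_transition N\<^sub>2 t"
  then show "net_abstraction N\<^sub>1 Q (remove_transition N\<^sub>2 t)"
    by (simp add: net_abstraction_iff reachable_remove_transition petri_net_def)
next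
  fix p I v b
  assume abs: "net_abstraction N\<^sub>1 Q N\<^sub>2" and red: "redundant_place N\<^sub>2 p I v b"
  \<comment> \<open>Needed to evaluate \<open>affine_expr\<close>, whose coefficient sum ranges over
    \<open>I\<close>.\<close>
  have "finite I"
    using red assms(3) finite_subset[of I "places N\<^sub>2"]
    by (auto simp: redundant_place_def petri_net_def)
  have "satisfies f (Eq (term_expr (v p) p) (affine_expr I v b)) \<longleftrightarrow>
      v p * f p = (\<Sum>q\<in>I. v q * f q) + b" for f
  proof -
    have "satisfies f (Eq (term_expr (v p) p) (affine_expr I v b)) \<longleftrightarrow>
        int (v p * f p) = int ((\<Sum>q\<in>I. v q * f q) + b)"
      using \<open>finite I\<close> by (simp add: expr_val_term_expr expr_val_affine_expr)
    then show ?thesis by (simp only: of_nat_eq_iff)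
  qed
  then show "net_abstraction N\<^sub>1 (Q @ [Eq (term_expr (v p) p) (affine_expr I v b)])
      (remove_place N\<^sub>2 p)"
    using reachable_remove_place[OF assms(3) red] assms(3)
    by (intro net_abstraction_append[OF abs]) (auto simp: petri_net_def)
next
  fix A a
  assume abs: "net_abstraction N\<^sub>1 Q N\<^sub>2"
    and A: "(chain_agglomerable N\<^sub>2 A \<or> loop_agglomerable N\<^sub>2 A) \<and>
      a \<notin> system_vars Q \<and> a \<notin> places N\<^sub>1 \<and> a \<notin> places N\<^sub>2"
  have "A \<subseteq> places N\<^sub>2"
    using A by (auto simp: chain_agglomerable_def loop_agglomerable_def)
  then show "net_abstraction N\<^sub>1 (Q @ [Eq (term_expr 1 a) (affine_expr A (\<lambda>_. 1) 0)])
      (agglomerate N\<^sub>2 A a)"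
  proof (rule net_abstraction_agglomerate[OF abs])
    show "restrict f (places N\<^sub>2) \<in> reachable N\<^sub>2"
      if "restrict f (insert a (places N\<^sub>2 - A)) \<in> reachable (agglomerate N\<^sub>2 A a)"
        "f a = (\<Sum>r\<in>A. f r)" for f
      using A that reachable_agglomerate_chain[of N\<^sub>2 A a f] reachable_agglomerate_loop[of N\<^sub>2 A a f]
      by argo
  qed (use A in argo)+
next
  fix p t k
  assume abs: "net_abstraction N\<^sub>1 Q N\<^sub>2" and k: "source_sink_pair N\<^sub>2 p t \<and> init N\<^sub>2 p = k"
  then show "net_abstraction N\<^sub>1 (Q @ [Le (term_expr 1 p) (affine_expr {} (\<lambda>_. 0) k)])
      (remove_source_sink_pair N\<^sub>2 p t)"
    using reachable_remove_source_sink_pair[of N\<^sub>2 p t] assms(3)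
    by (intro net_abstraction_append[OF abs])
      (auto simp: petri_net_def expr_val_term_expr expr_val_affine_expr)
qed

end
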